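(* For every $n$, let $T$ be a random tournament on alternatives $x_1,\dots,x_n$ generated according to the generalized random model with probabilities $p_{i,j}$ satisfying $p_{i,j} \in \left[50\log n/n,\ 1 - 50\log n/n\right]$ for all $i\neq j$. Then with high probability (i.e., with probability tending to $1$ as $n\to\infty$), at least $0.9n$ alternatives in $T$ are $2$-kings.
   Context: A tournament on a finite set $V$ of alternatives is a complete orientation: for every two distinct $x,y\in V$ exactly one of $x\succ y$ ("$x$ dominates $y$") or $y\succ x$ holds. An alternative $x$ is a $2$-king if for every other alternative $y$ there is a directed path from $x$ to $y$ of length at most $2$ (i.e., $x\succ y$, or $x\succ z\succ y$ for some $z$). Generalized random model: for each ordered pair $i\neq j$ there is a number $p_{i,j}\in[0,1]$ with $p_{i,j}+p_{j,i}=1$; independently for each unordered pair $\{i,j\}$, $x_i\succ x_j$ with probability $p_{i,j}$ and otherwise $x_j\succ x_i$. $\log$ is the natural logarithm. *)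

theory Defs
  imports "HOL-Probability.Probability"
begin

text \<open>A dominance relation is the set of pairs \<open>(x, y)\<close> such that \<open>x\<close> dominates \<open>y\<close>.\<close>

definition tournament :: "'a set \<Rightarrow> ('a \<times> 'a) set \<Rightarrow> bool" where
  "tournament V T \<longleftrightarrow> finite V \<and> T \<subseteq> V \<times> V \<and> irrefl T \<and>
     (\<forall>x\<in>V. \<forall>y\<in>V. x \<noteq> y \<longrightarrow> ((x, y) \<in> T \<longleftrightarrow> (y, x) \<notin> T))"

definition two_king :: "'a set \<Rightarrow> ('a \<times> 'a) set \<Rightarrow> 'a \<Rightarrow> bool" where
  "two_king V T x \<longleftrightarrow> x \<in> V \<and>
     (\<forall>y\<in>V. y \<noteq> x \<longrightarrow> (x, y) \<in> T \<or> (\<exists>z\<in>V. (x, z) \<in> T \<and> (z, y) \<in> T))"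

definition dominance_probs :: "nat \<Rightarrow> (nat \<Rightarrow> nat \<Rightarrow> real) \<Rightarrow> bool" where
  "dominance_probs n p \<longleftrightarrow>
     (\<forall>i\<in>{1..n}. \<forall>j\<in>{1..n}. i \<noteq> j \<longrightarrow> p i j \<in> {0..1} \<and> p i j + p j i = 1)"

text \<open>An unordered pair of distinct alternatives is represented by \<open>(i, j)\<close> with \<open>i < j\<close>.\<close>

definition pairs :: "nat \<Rightarrow> (nat \<times> nat) set" where
  "pairs n = {(i, j). 1 \<le> i \<and> i < j \<and> j \<le> n}"

text \<open>The outcome \<open>f (i, j)\<close> of the coin for a pair \<open>i < j\<close> says whether \<open>i\<close> dominates \<open>j\<close>.\<close>

definition tournament_of :: "nat \<Rightarrow> (nat \<times> nat \<Rightarrow> bool) \<Rightarrow> (nat \<times> nat) set" where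
  "tournament_of n f =
     {(i, j). (i, j) \<in> pairs n \<and> f (i, j)} \<union> {(j, i). (i, j) \<in> pairs n \<and> \<not> f (i, j)}"

text \<open>
  The coins are independent, as \<open>Pi_pmf\<close> is the product distribution; its second argument is
  only the value taken outside of \<open>pairs n\<close>. The parameter of \<open>bernoulli_pmf\<close> is clamped to
  the unit interval, which has no effect under \<open>dominance_probs n p\<close>.
\<close>

definition random_tournament :: "nat \<Rightarrow> (nat \<Rightarrow> nat \<Rightarrow> real) \<Rightarrow> (nat \<times> nat) set pmf" where
  "random_tournament n p =
     map_pmf (tournament_of n) (Pi_pmf (pairs n) False (\<lambda>(i, j). bernoulli_pmf (p i j)))"

lemma finite_pairs [simp]: "finite (pairs n)"
  by (rule finite_subset[of _ "{1..n} \<times> {1..n}"]) (auto simp: pairs_def)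

lemma tournament_tournament_of: "tournament {1..n} (tournament_of n f)"
  unfolding tournament_def tournament_of_def pairs_def irrefl_def
  by (auto simp: not_less)

lemma tournament_random_tournament:
  "T \<in> set_pmf (random_tournament n p) \<Longrightarrow> tournament {1..n} T"
  unfolding random_tournament_def using tournament_tournament_of by force

lemma prob_coin:
  assumes "(i, j) \<in> pairs n" "p i j \<in> {0..1}"
  shows "measure_pmf.prob (Pi_pmf (pairs n) False (\<lambda>(i, j). bernoulli_pmf (p i j)))
           {f. f (i, j)} = p i j"
proof -
  let ?P = "Pi_pmf (pairs n) False (\<lambda>(i, j). bernoulli_pmf (p i j))"
  have "measure_pmf.prob ?P {f. f (i, j)} = measure_pmf.prob (map_pmf (\<lambda>f. f (i, j)) ?P) {True}"
    by (simp add: vimage_def)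
  also have "map_pmf (\<lambda>f. f (i, j)) ?P = bernoulli_pmf (p i j)"
    using assms by (subst Pi_pmf_component) auto
  finally show ?thesis using assms by (simp add: measure_pmf_single)
qed

lemma prob_dominates:
  assumes "dominance_probs n p" "i \<in> {1..n}" "j \<in> {1..n}" "i \<noteq> j"
  shows "measure_pmf.prob (random_tournament n p) {T. (i, j) \<in> T} = p i j"
proof -
  let ?P = "Pi_pmf (pairs n) False (\<lambda>(i, j). bernoulli_pmf (p i j))"
  have p: "p i j \<in> {0..1}" "p j i \<in> {0..1}" "p i j = 1 - p j i"
    using assms unfolding dominance_probs_def by (auto simp: eq_diff_eq)
  show ?thesis
  proof (cases "i < j")
    case True
    have "tournament_of n -` {T. (i, j) \<in> T} = {f. f (i, j)}"
      using assms True by (auto simp: tournament_of_def pairs_def)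
    then have "measure_pmf.prob (random_tournament n p) {T. (i, j) \<in> T} =
        measure_pmf.prob ?P {f. f (i, j)}"
      by (simp add: random_tournament_def)
    also have "\<dots> = p i j"
      using assms True p by (intro prob_coin) (auto simp: pairs_def)
    finally show ?thesis .
  next
    case False
    have "tournament_of n -` {T. (i, j) \<in> T} = UNIV - {f. f (j, i)}"
      using assms False by (auto simp: tournament_of_def pairs_def)
    then have "measure_pmf.prob (random_tournament n p) {T. (i, j) \<in> T} =
        1 - measure_pmf.prob ?P {f. f (j, i)}"
      using measure_pmf.prob_compl[of "{f. f (j, i)}" ?P] by (simp add: random_tournament_def)
    also have "measure_pmf.prob ?P {f. f (j, i)} = p j i"
      using assms False p by (intro prob_coin) (auto simp: pairs_def)
    finally show ?thesis using p by simp
  qed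
qed

end

theory Submission imports Defs begin

text \<open>
  Call \<open>\<Sum>z\<noteq>x. p x z\<close> the expected score of \<open>x\<close>. Any set \<open>S\<close> contains an alternative that
  expects to beat at least \<open>(\<bar>S\<bar> - 1) / 2\<close> others, so all but \<open>0.08 n + 3\<close> alternatives have expected
  score above \<open>0.04 n + 1\<close>. For such an \<open>x\<close> and any \<open>y\<close>, the paths \<open>x \<succ> z \<succ> y\<close> use disjoint
  pairs for different \<open>z\<close>, so none of them is present with probability at most
  \<open>exp (- (\<Sum>z. p x z * p z y)) \<le> exp (- 0.04 n * 50 ln n / n) = 1 / n\<^sup>2\<close>. By the union bound
  \<open>x\<close> fails to be a 2-king with probability at most \<open>1 / n\<close>, and Markov's inequality applied to the
  number of such failures finishes the proof.
\<close>

section \<open>Independence of events on disjoint blocks of coins\<close>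

text \<open>Restrictions of an independent family to disjoint index blocks are independent, and by
  the last assumption each event factors through the restriction to its own block.\<close>

lemma indep_events_Pi_pmf_disjoint:
  fixes p :: "'a \<Rightarrow> 'b :: countable pmf"
  assumes "finite I" and "disjoint_family_on K J" and sub: "\<And>j. j \<in> J \<Longrightarrow> K j \<subseteq> I"
    and dep: "\<And>j f g. j \<in> J \<Longrightarrow> (\<And>i. i \<in> K j \<Longrightarrow> f i = g i) \<Longrightarrow> P j f \<longleftrightarrow> P j g"
  shows "prob_space.indep_events (measure_pmf (Pi_pmf I d p)) (\<lambda>j. {f. P j f}) J"
proof -
  let ?M = "measure_pmf (Pi_pmf I d p)"
  note ps = measure_pmf.prob_space_axioms[of "Pi_pmf I d p"]
  have "prob_space.indep_vars ?M (\<lambda>j. PiM (K j) (\<lambda>_. count_space UNIV)) (\<lambda>j f. restrict (\<lambda>i. f i) (K j)) J"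
    using assms by (intro prob_space.indep_vars_restrict[OF ps indep_vars_Pi_pmf]) auto
  then have "prob_space.indep_events ?M (\<lambda>j. {f \<in> space ?M. P j (restrict f (K j))}) J"
  proof (rule prob_space.indep_eventsI_indep_vars[OF ps])
    fix j assume "j \<in> J"
    then have "finite (K j)"
      using sub assms(1) finite_subset by blast
    \<comment> \<open>A finite product of countable discrete spaces is discrete, so an arbitrary
      predicate on the block is measurable.\<close>
    then have "PiM (K j) (\<lambda>_. count_space (UNIV :: 'b set)) = count_space (K j \<rightarrow>\<^sub>E UNIV)"
      by (intro count_space_PiM_finite) auto
    then show "{f \<in> space (PiM (K j) (\<lambda>_. count_space (UNIV :: 'b set))). P j f}
        \<in> sets (PiM (K j) (\<lambda>_. count_space UNIV))"
      by simp
  qed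
  moreover have "{f \<in> space ?M. P j (restrict f (K j))} = {f. P j f}" if "j \<in> J" for j
    using dep[OF that, of "restrict _ (K j)"] by auto
  ultimately show ?thesis
    unfolding prob_space.indep_events_def_alt[OF ps] by (subst (asm) prob_space.indep_sets_cong[OF ps refl]) auto
qed

lemma prob_Pi_pmf_disjoint:
  fixes p :: "'a \<Rightarrow> 'b :: countable pmf"
  assumes "finite I" "disjoint_family_on K J" "\<And>j. j \<in> J \<Longrightarrow> K j \<subseteq> I" "finite J"
    and "\<And>j f g. j \<in> J \<Longrightarrow> (\<And>i. i \<in> K j \<Longrightarrow> f i = g i) \<Longrightarrow> P j f \<longleftrightarrow> P j g"
  shows "measure_pmf.prob (Pi_pmf I d p) {f. \<forall>j\<in>J. P j f} =
    (\<Prod>j\<in>J. measure_pmf.prob (Pi_pmf I d p) {f. P j f})"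
\<comment> \<open>Independence speaks of nonempty index sets only; for empty \<open>J\<close> both
  sides are 1.\<close>
proof (cases "J = {}")
  case False
  have "{f. \<forall>j\<in>J. P j f} = (\<Inter>j\<in>J. {f. P j f})"
    by auto
  moreover have "prob_space.indep_events (measure_pmf (Pi_pmf I d p)) (\<lambda>j. {f. P j f}) J"
    by (rule indep_events_Pi_pmf_disjoint[OF assms(1,2,3,5)])
  ultimately show ?thesis
    unfolding prob_space.indep_events_def[OF measure_pmf.prob_space_axioms]
    using False assms(4) by simp
qed simp

section \<open>Paths of length two\<close>

text \<open>The coordinate that decides between \<open>x\<close> and \<open>y\<close>, whichever of
  them is smaller. It spares later arguments the case split on the order.\<close>

definition coin :: "nat \<Rightarrow> nat \<Rightarrow> nat \<times> nat" where
  "coin x y = (min x y, max x y)"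

lemma coin_in_pairs: "x \<in> {1..n} \<Longrightarrow> y \<in> {1..n} \<Longrightarrow> x \<noteq> y \<Longrightarrow> coin x y \<in> pairs n"
  by (auto simp: coin_def pairs_def)

lemma coin_eq_iff: "coin x y = coin u v \<longleftrightarrow> {x, y} = {u, v}"
  by (auto simp: coin_def doubleton_eq_iff min_def max_def split: if_splits)

lemma tournament_of_cong_coin:
  fixes f g :: "nat \<times> nat \<Rightarrow> bool"
  shows "f (coin x y) = g (coin x y) \<Longrightarrow> (x, y) \<in> tournament_of n f \<longleftrightarrow> (x, y) \<in> tournament_of n g"
  by (cases x y rule: linorder_cases) (auto simp: tournament_of_def pairs_def coin_def)

text \<open>As \<open>x\<close> and \<open>y\<close> differ, the two edges of the path are decided
  by different coins.\<close>

lemma prob_path: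
  assumes p: "dominance_probs n p"
    and "x \<in> {1..n}" "z \<in> {1..n}" "y \<in> {1..n}" "x \<noteq> z" "z \<noteq> y" "x \<noteq> y"
  shows "measure_pmf.prob (random_tournament n p) {T. (x, z) \<in> T \<and> (z, y) \<in> T} = p x z * p z y"
proof -
  let ?P = "Pi_pmf (pairs n) False (\<lambda>(i, j). bernoulli_pmf (p i j))"
  \<comment> \<open>Indexing the two edges by \<open>bool\<close> turns the conjunction into a
    bounded quantifier, as the product rule expects.\<close>
  let ?e = "case_bool (x, z) (z, y)"
  have "measure_pmf.prob ?P {f. \<forall>b\<in>UNIV. ?e b \<in> tournament_of n f} =
      (\<Prod>b\<in>UNIV. measure_pmf.prob ?P {f. ?e b \<in> tournament_of n f})"
  proof (rule prob_Pi_pmf_disjoint[where K = "\<lambda>b. {case_prod coin (?e b)}"])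
    show "disjoint_family_on (\<lambda>b. {case_prod coin (?e b)}) UNIV"
      using assms by (auto simp: disjoint_family_on_def coin_eq_iff split: bool.splits)
    fix b and f g :: "nat \<times> nat \<Rightarrow> bool"
    assume "\<And>i. i \<in> {case_prod coin (?e b)} \<Longrightarrow> f i = g i"
    then show "?e b \<in> tournament_of n f \<longleftrightarrow> ?e b \<in> tournament_of n g"
      by (cases b) (auto simp: tournament_of_cong_coin[of f _ _ g])
  qed (use assms in \<open>auto simp: coin_in_pairs split: bool.splits\<close>)
  then show ?thesis
    using assms prob_dominates[OF p, of x z] prob_dominates[OF p, of z y]
    by (simp add: UNIV_bool ex_bool_eq random_tournament_def vimage_def conj_commute mult.commute)
qed

text \<open>The middle vertex \<open>z\<close> is the only vertex outside \<open>x\<close> and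
  \<open>y\<close> on its path, so different \<open>z\<close> use different coins. The probability
  is thus a product of factors \<open>1 - t\<close>, each at most \<open>exp (- t)\<close>.\<close>

lemma prob_no_path_le:
  assumes p: "dominance_probs n p" and "x \<in> {1..n}" "y \<in> {1..n}" "x \<noteq> y"
  shows "measure_pmf.prob (random_tournament n p) {T. \<forall>z\<in>{1..n} - {x, y}. \<not> ((x, z) \<in> T \<and> (z, y) \<in> T)}
    \<le> exp (- (\<Sum>z\<in>{1..n} - {x, y}. p x z * p z y))"
proof -
  let ?P = "Pi_pmf (pairs n) False (\<lambda>(i, j). bernoulli_pmf (p i j))"
  let ?Z = "{1..n} - {x, y}"
  have "measure_pmf.prob (random_tournament n p) {T. \<forall>z\<in>?Z. \<not> ((x, z) \<in> T \<and> (z, y) \<in> T)} =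
      measure_pmf.prob ?P {f. \<forall>z\<in>?Z. \<not> ((x, z) \<in> tournament_of n f \<and> (z, y) \<in> tournament_of n f)}"
    by (simp add: random_tournament_def vimage_def)
  also have "\<dots> = (\<Prod>z\<in>?Z. measure_pmf.prob ?P
      {f. \<not> ((x, z) \<in> tournament_of n f \<and> (z, y) \<in> tournament_of n f)})"
  proof (rule prob_Pi_pmf_disjoint[where K = "\<lambda>z. {coin x z, coin z y}"])
    show "disjoint_family_on (\<lambda>z. {coin x z, coin z y}) ?Z"
      by (auto simp: disjoint_family_on_def coin_eq_iff doubleton_eq_iff)
    fix z and f g :: "nat \<times> nat \<Rightarrow> bool"
    assume "\<And>i. i \<in> {coin x z, coin z y} \<Longrightarrow> f i = g i"
    then show "\<not> ((x, z) \<in> tournament_of n f \<and> (z, y) \<in> tournament_of n f) \<longleftrightarrow>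
        \<not> ((x, z) \<in> tournament_of n g \<and> (z, y) \<in> tournament_of n g)"
      using tournament_of_cong_coin by (metis insertI1 insertI2)
  qed (use assms in \<open>auto simp: coin_in_pairs\<close>)
  also have "\<dots> = (\<Prod>z\<in>?Z. 1 - p x z * p z y)"
  proof (rule prod.cong[OF refl])
    fix z assume z: "z \<in> ?Z"
    let ?A = "{f. (x, z) \<in> tournament_of n f \<and> (z, y) \<in> tournament_of n f}"
    have "measure_pmf.prob ?P ?A = p x z * p z y"
      using prob_path[OF p, of x z y] z assms by (auto simp: random_tournament_def vimage_def)
    then have "measure_pmf.prob ?P (- ?A) = 1 - p x z * p z y"
      using measure_pmf.prob_compl[of ?A ?P] by (simp add: Compl_eq_Diff_UNIV)
    then show "measure_pmf.prob ?P
        {f. \<not> ((x, z) \<in> tournament_of n f \<and> (z, y) \<in> tournament_of n f)} = 1 - p x z * p z y"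
      by (simp add: Collect_neg_eq[symmetric])
  qed
  also have "\<dots> \<le> (\<Prod>z\<in>?Z. exp (- (p x z * p z y)))"
  proof (rule prod_mono, intro conjI)
    fix z assume z: "z \<in> ?Z"
    then have "p x z \<in> {0..1}" "p z y \<in> {0..1}"
      using p assms unfolding dominance_probs_def by auto
    then show "0 \<le> 1 - p x z * p z y"
      by (simp add: mult_le_one)
    show "1 - p x z * p z y \<le> exp (- (p x z * p z y))"
      using exp_ge_add_one_self[of "- (p x z * p z y)"] by simp
  qed
  also have "\<dots> = exp (- (\<Sum>z\<in>?Z. p x z * p z y))"
    by (simp add: exp_sum sum_negf[symmetric])
  finally show ?thesis .
qed

section \<open>Expected scores and Markov's inequality\<close>

text \<open>Double counting: each pair inside the set contributes \<open>p x z + p z x = 1\<close>,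
  so with \<open>s\<close> members the scores inside it add up to \<open>s * (s - 1) / 2\<close>,
  yet they total at most \<open>s * c\<close>.\<close>

lemma card_low_score_le:
  assumes p: "dominance_probs n p" and "c \<ge> 0"
  shows "real (card {x \<in> {1..n}. (\<Sum>z\<in>{1..n} - {x}. p x z) \<le> c}) \<le> 2 * c + 1"
proof -
  define S where "S = {x \<in> {1..n}. (\<Sum>z\<in>{1..n} - {x}. p x z) \<le> c}"
  have fin: "finite S" and S: "S \<subseteq> {1..n}"
    by (auto simp: S_def)
  have pp: "p x z \<ge> 0" "p x z + p z x = 1" if "x \<in> {1..n}" "z \<in> {1..n}" "x \<noteq> z" for x z
    using p that unfolding dominance_probs_def by auto
  \<comment> \<open>The zero diagonal lets the sums run over the full square \<open>S\<close> times
    \<open>S\<close>, where swapping the two summations is immediate.\<close>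
  define q where "q x z = (if x = z then 0 else p x z)" for x z
  have "real (card S) * (real (card S) - 1) = (\<Sum>x\<in>S. \<Sum>z\<in>S - {x}. 1)"
    using fin by (cases "S = {}") (auto simp: of_nat_diff card_gt_0_iff Suc_le_eq)
  also have "\<dots> = (\<Sum>x\<in>S. \<Sum>z\<in>S. q x z + q z x)"
    using fin S pp by (intro sum.cong[OF refl] sum.mono_neutral_cong_left) (auto simp: q_def subset_iff)
  also have "\<dots> = 2 * (\<Sum>x\<in>S. \<Sum>z\<in>S. q x z)"
    using sum.swap[of "\<lambda>x z. q z x" S S] by (simp add: sum.distrib)
  also have "(\<Sum>x\<in>S. \<Sum>z\<in>S. q x z) \<le> (\<Sum>x\<in>S. c)"
  proof (rule sum_mono)
    fix x assume x: "x \<in> S"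
    have "(\<Sum>z\<in>S. q x z) = (\<Sum>z\<in>S - {x}. p x z)"
      using fin by (intro sum.mono_neutral_cong_right) (auto simp: q_def)
    also have "\<dots> \<le> (\<Sum>z\<in>{1..n} - {x}. p x z)"
      using x S pp by (intro sum_mono2) auto
    finally show "(\<Sum>z\<in>S. q x z) \<le> c"
      using x by (simp add: S_def)
  qed
  finally have "real (card S) * (real (card S) - 1) \<le> real (card S) * (2 * c)"
    by simp
  then show ?thesis
    unfolding S_def[symmetric] using \<open>c \<ge> 0\<close>
    by (cases "card S = 0") (auto dest: mult_left_le_imp_le)
qed

text \<open>Markov's inequality for a count written as a sum of indicators; linearity of expectation
  copes with dependent events.\<close>

lemma prob_card_ge_le:
  fixes M :: "'a pmf"
  assumes "finite A" and "\<And>x. x \<in> A \<Longrightarrow> measure_pmf.prob M {T. P x T} \<le> q" and "c > 0"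
  shows "measure_pmf.prob M {T. real (card {x \<in> A. P x T}) \<ge> c} \<le> real (card A) * q / c"
proof -
  have eq: "real (card {x \<in> A. P x T}) = (\<Sum>x\<in>A. indicator {T. P x T} T)" for T
    using assms(1) by (simp add: indicator_def sum.If_cases Int_def)
  have int: "integrable M (\<lambda>T. indicator {T. P x T} T :: real)" for x
    by (rule measure_pmf.integrable_const_bound[where B = 1]) auto
  have "measure_pmf.prob M {T \<in> space M. real (card {x \<in> A. P x T}) \<ge> c} \<le>
      measure_pmf.expectation M (\<lambda>T. real (card {x \<in> A. P x T})) / c"
    using \<open>c > 0\<close> by (intro integral_Markov_inequality_measure[where A = UNIV]) (auto simp: eq int sum_nonneg)
  also have "measure_pmf.expectation M (\<lambda>T. real (card {x \<in> A. P x T})) =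
      (\<Sum>x\<in>A. measure_pmf.prob M {T. P x T})"
    by (simp add: eq int)
  also have "\<dots> \<le> real (card A) * q"
    using assms by (intro sum_bounded_above) auto
  finally show ?thesis
    using \<open>c > 0\<close> by (simp add: divide_right_mono)
qed

section \<open>Counting 2-kings\<close>

lemma prob_not_two_king_le:
  assumes p: "dominance_probs n p" and x: "x \<in> {1..n}" and "n \<ge> 1"
    and low: "\<And>i j. i \<in> {1..n} \<Longrightarrow> j \<in> {1..n} \<Longrightarrow> i \<noteq> j \<Longrightarrow> p i j \<ge> 50 * ln (real n) / real n"
    and score: "(\<Sum>z\<in>{1..n} - {x}. p x z) \<ge> 0.04 * real n + 1"
  shows "measure_pmf.prob (random_tournament n p) {T. \<not> two_king {1..n} T x} \<le> 1 / real n"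
proof -
  let ?R = "random_tournament n p"
  let ?E = "\<lambda>y. {T. \<forall>z\<in>{1..n} - {x, y}. \<not> ((x, z) \<in> T \<and> (z, y) \<in> T)}"
  have "measure_pmf.prob ?R (?E y) \<le> 1 / (real n)\<^sup>2" if y: "y \<in> {1..n} - {x}" for y
  proof -
    \<comment> \<open>The extra 1 in the score bound pays for \<open>p x y\<close>, since
      \<open>y\<close> cannot be a middle vertex.\<close>
    have "(\<Sum>z\<in>{1..n} - {x}. p x z) = p x y + (\<Sum>z\<in>{1..n} - {x} - {y}. p x z)"
      using y by (intro sum.remove) auto
    moreover have "p x y \<le> 1" "{1..n} - {x} - {y} = {1..n} - {x, y}"
      using p x y by (auto simp: dominance_probs_def)
    ultimately have "0.04 * real n \<le> (\<Sum>z\<in>{1..n} - {x, y}. p x z)"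
      using score by simp
    then have "0.04 * real n * (50 * ln (real n) / real n) \<le>
        (\<Sum>z\<in>{1..n} - {x, y}. p x z) * (50 * ln (real n) / real n)"
      using \<open>n \<ge> 1\<close> by (intro mult_right_mono) auto
    also have "\<dots> \<le> (\<Sum>z\<in>{1..n} - {x, y}. p x z * p z y)"
      unfolding sum_distrib_right using p x y low
      by (intro sum_mono mult_left_mono) (auto simp: dominance_probs_def)
    \<comment> \<open>The constants are matched here: 0.04 times 50 is 2, which gives failure
      probability \<open>1 / n^2\<close> for each \<open>y\<close>.\<close>
    finally have "2 * ln (real n) \<le> (\<Sum>z\<in>{1..n} - {x, y}. p x z * p z y)"
      using \<open>n \<ge> 1\<close> by simp
    then have "measure_pmf.prob ?R (?E y) \<le> exp (- (2 * ln (real n)))"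
      using prob_no_path_le[OF p x, of y] y by (auto intro: order.trans)
    also have "\<dots> = 1 / (real n)\<^sup>2"
      using \<open>n \<ge> 1\<close> by (simp add: exp_minus exp_double inverse_eq_divide)
    finally show ?thesis .
  qed
  note E = this
  \<comment> \<open>Disregarding a direct edge from \<open>x\<close> to \<open>y\<close> only
    enlarges the failure event.\<close>
  have "measure_pmf.prob ?R {T. \<not> two_king {1..n} T x} \<le> measure_pmf.prob ?R (\<Union>y\<in>{1..n} - {x}. ?E y)"
    using x by (intro measure_pmf.finite_measure_mono) (auto simp: two_king_def)
  also have "\<dots> \<le> (\<Sum>y\<in>{1..n} - {x}. measure_pmf.prob ?R (?E y))"
    by (intro measure_pmf.finite_measure_subadditive_finite) auto
  also have "\<dots> \<le> real (card ({1..n} - {x})) * (1 / (real n)\<^sup>2)"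
    using E by (intro sum_bounded_above) auto
  also have "\<dots> \<le> real n * (1 / (real n)\<^sup>2)"
    using x by (intro mult_right_mono) auto
  also have "\<dots> = 1 / real n"
    by (simp add: power2_eq_square)
  finally show ?thesis .
qed

lemma prob_many_two_kings_ge:
  assumes p: "dominance_probs n p" and n: "n \<ge> 300"
    and low: "\<And>i j. i \<in> {1..n} \<Longrightarrow> j \<in> {1..n} \<Longrightarrow> i \<noteq> j \<Longrightarrow> p i j \<ge> 50 * ln (real n) / real n"
  shows "measure_pmf.prob (random_tournament n p)
    {T. real (card {x \<in> {1..n}. two_king {1..n} T x}) \<ge> 0.9 * real n} \<ge> 1 - 100 / real n"
proof -
  let ?R = "random_tournament n p"
  let ?A = "{T. real (card {x \<in> {1..n}. two_king {1..n} T x}) \<ge> 0.9 * real n}"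
  define S where "S = {x \<in> {1..n}. (\<Sum>z\<in>{1..n} - {x}. p x z) \<le> 0.04 * real n + 1}"
  define G where "G = {1..n} - S"
  let ?B = "{T. real (card {x \<in> G. \<not> two_king {1..n} T x}) \<ge> 0.01 * real n}"
  have S: "real (card S) \<le> 0.08 * real n + 3"
    unfolding S_def using card_low_score_le[OF p, of "0.04 * real n + 1"] by simp
  have "measure_pmf.prob ?R ?B \<le> real (card G) * (1 / real n) / (0.01 * real n)"
    using n p low by (intro prob_card_ge_le prob_not_two_king_le) (auto simp: G_def S_def)
  also have "\<dots> \<le> real n * (1 / real n) / (0.01 * real n)"
    using card_mono[of "{1..n}" G] by (intro divide_right_mono mult_right_mono) (auto simp: G_def)
  also have "\<dots> = 100 / real n"
    using n by simp
  finally have B: "measure_pmf.prob ?R ?B \<le> 100 / real n" .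
  have "- ?B \<subseteq> ?A"
  proof
    fix T assume T: "T \<in> - ?B"
    let ?K = "{x \<in> {1..n}. two_king {1..n} T x}" and ?N = "{x \<in> G. \<not> two_king {1..n} T x}"
    have "card {1..n} \<le> card (?K \<union> (S \<union> ?N))"
      by (intro card_mono) (auto simp: G_def S_def)
    also have "\<dots> \<le> card ?K + (card S + card ?N)"
      by (meson card_Un_le add_left_mono order.trans)
    finally have "real n \<le> real (card ?K) + real (card S) + real (card ?N)"
      by simp
    \<comment> \<open>For \<open>n \<ge> 300\<close> the 3 in the bound on \<open>S\<close> is at
      most \<open>0.01 * n\<close>, so at most \<open>(0.08 + 0.01 + 0.01) * n\<close> alternatives
      are lost.\<close>
    then show "T \<in> ?A"
      using S T n by simp
  qed
  then have "measure_pmf.prob ?R (- ?B) \<le> measure_pmf.prob ?R ?A"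
    by (intro measure_pmf.finite_measure_mono) auto
  moreover have "measure_pmf.prob ?R (- ?B) = 1 - measure_pmf.prob ?R ?B"
    using measure_pmf.prob_compl[of ?B ?R] by (simp add: Compl_eq_Diff_UNIV)
  ultimately show ?thesis
    using B by simp
qed

theorem theorem7:
  fixes p :: "nat \<Rightarrow> nat \<Rightarrow> nat \<Rightarrow> real"
  assumes "\<And>n. dominance_probs n (p n)"
    and "\<forall>\<^sub>F n in sequentially. \<forall>i\<in>{1..n}. \<forall>j\<in>{1..n}. i \<noteq> j \<longrightarrow>
           p n i j \<in> {50 * ln (real n) / real n .. 1 - 50 * ln (real n) / real n}"
  shows "(\<lambda>n. measure_pmf.prob (random_tournament n (p n))
            {T. real (card {x \<in> {1..n}. two_king {1..n} T x}) \<ge> 0.9 * real n}) \<longlonglongrightarrow> 1"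
proof (rule tendsto_sandwich)
  show "(\<lambda>n. 1 - 100 / real n) \<longlonglongrightarrow> 1"
    by (auto intro!: tendsto_eq_intros lim_const_over_n)
  show "\<forall>\<^sub>F n in sequentially. 1 - 100 / real n \<le> measure_pmf.prob (random_tournament n (p n))
      {T. real (card {x \<in> {1..n}. two_king {1..n} T x}) \<ge> 0.9 * real n}"
    using assms(2) eventually_ge_at_top[of 300]
    by eventually_elim (intro prob_many_two_kings_ge assms(1), auto)
qed auto

end
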